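(* Let $N, D \ge 1$, let $\mathcal{G} = (\mathcal{V}, \mathcal{E})$ be a graph with node set $\mathcal{V} = \{1,\dots,N\}$, and let each node $i$ carry a feature vector $x_i \in \mathbb{R}^D$. Let $\mathcal{N}_i = \{i\} \cup \{j : (i,j) \in \mathcal{E}\}$, let $\psi(\cdot,\cdot;\theta_a) : \mathbb{R}^D \times \mathbb{R}^D \to \mathbb{R}$ be a function (with fixed parameters $\theta_a$), and let $\boldsymbol{W} \in \mathbb{R}^{N \times N}$ be the stochastic matrix with entries $[\boldsymbol{W}]_{i,j} = \alpha_{i,j}$, where $$\alpha_{i,j} = \frac{e^{\psi(x_i, x_j; \theta_a)}}{\sum_{k \in \mathcal{N}_i} e^{\psi(x_i, x_k; \theta_a)}} \text{ if } j \in \mathcal{N}_i, \qquad \alpha_{i,j} = 0 \text{ otherwise}.$$ Let $\boldsymbol{X} \in \mathbb{R}^{N \times D}$ be the node feature matrix whose $i$-th row is $x_i$, and let $\boldsymbol{X}^{[k]}$ be the $k$-th iterate of $\boldsymbol{X}$ under recurrent graph aggregation, i.e. $\boldsymbol{X}^{[0]} = \boldsymbol{X}$ and $\boldsymbol{X}^{[k+1]} = \boldsymbol{W}\boldsymbol{X}^{[k]}$ for all $k \ge 0$. Then the limit $$\lim_{k \to \infty} \boldsymbol{W} \boldsymbol{X}^{[k]} = \boldsymbol{X}^{*}$$ exists, for some matrix $\boldsymbol{X}^{*} \in \mathbb{R}^{N\times D}$.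
   Context: The recurrent graph aggregation updates the node features row-wise by $x_i^{[k+1]} = \sum_{j \in \mathcal{N}_i} \alpha_{i,j}\, x_j^{[k]}$ with $x_i^{[0]} = x_i$, where $x_i^{[k]}$ is the $i$-th row of $\boldsymbol{X}^{[k]}$. The attention coefficients $\alpha_{i,j}$ are computed once from the initial features $x_1,\dots,x_N$ and are held fixed throughout the iteration. The neighbourhood $\mathcal{N}_i$ always contains the node $i$ itself. A stochastic matrix is a square matrix with nonnegative entries whose rows each sum to $1$. *)

theory Defs
  imports "HOL-Analysis.Analysis"
begin

text \<open>
  The node set is the finite index type \<open>'n\<close> (so \<open>N = CARD('n)\<close>, automatically at least 1) and
  the feature space is \<open>real ^ 'd\<close> (so \<open>D = CARD('d)\<close>). A graph on \<open>'n\<close> is given by its set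
  \<open>E\<close> of ordered pairs; it is arbitrary, so that directed and undirected (symmetric \<open>E\<close>) graphs,
  with or without self-loops, are all covered.
\<close>

definition nbhd :: "('n \<times> 'n) set \<Rightarrow> 'n \<Rightarrow> 'n set" where
  "nbhd E i = {i} \<union> {j. (i, j) \<in> E}"

definition attention ::
  "('n::finite \<times> 'n) set \<Rightarrow> (real ^ 'd \<Rightarrow> real ^ 'd \<Rightarrow> 'p \<Rightarrow> real) \<Rightarrow> 'p \<Rightarrow>
   ('n \<Rightarrow> real ^ 'd) \<Rightarrow> 'n \<Rightarrow> 'n \<Rightarrow> real" where
  "attention E \<psi> \<theta> x i j =
     (if j \<in> nbhd E i
      then exp (\<psi> (x i) (x j) \<theta>) / (\<Sum>k\<in>nbhd E i. exp (\<psi> (x i) (x k) \<theta>))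
      else 0)"

definition attention_matrix ::
  "('n::finite \<times> 'n) set \<Rightarrow> (real ^ 'd \<Rightarrow> real ^ 'd \<Rightarrow> 'p \<Rightarrow> real) \<Rightarrow> 'p \<Rightarrow>
   ('n \<Rightarrow> real ^ 'd) \<Rightarrow> real ^ 'n ^ 'n" where
  "attention_matrix E \<psi> \<theta> x = (\<chi> i j. attention E \<psi> \<theta> x i j)"

definition feature_matrix :: "('n::finite \<Rightarrow> real ^ 'd) \<Rightarrow> real ^ 'd ^ 'n" where
  "feature_matrix x = (\<chi> i. x i)"

primrec recurrent_aggregation ::
  "real ^ 'n ^ 'n \<Rightarrow> real ^ 'd ^ 'n \<Rightarrow> nat \<Rightarrow> real ^ 'd ^ 'n" where
  "recurrent_aggregation W X 0 = X"
| "recurrent_aggregation W X (Suc k) = W ** recurrent_aggregation W X k"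

definition stochastic :: "real ^ 'n ^ 'n \<Rightarrow> bool" where
  "stochastic W \<longleftrightarrow> (\<forall>i j. 0 \<le> W $ i $ j) \<and> (\<forall>i. (\<Sum>j\<in>UNIV. W $ i $ j) = 1)"

lemma stochastic_attention_matrix:
  fixes E :: "('n::finite \<times> 'n) set"
  shows "stochastic (attention_matrix E \<psi> \<theta> x)"
proof -
  have pos: "0 < (\<Sum>k\<in>nbhd E i. exp (\<psi> (x i) (x k) \<theta>))" for i
    by (rule sum_pos) (auto simp: nbhd_def)
  have "(\<Sum>j\<in>UNIV. attention E \<psi> \<theta> x i j) = 1" for i
  proof -
    have "(\<Sum>j\<in>UNIV. attention E \<psi> \<theta> x i j) =
        (\<Sum>j\<in>nbhd E i. exp (\<psi> (x i) (x j) \<theta>) / (\<Sum>k\<in>nbhd E i. exp (\<psi> (x i) (x k) \<theta>)))"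
      by (rule sum.mono_neutral_cong_right) (auto simp: attention_def)
    also have "\<dots> = 1"
      using pos[of i] by (simp flip: sum_divide_distrib)
    finally show ?thesis .
  qed
  moreover have "0 \<le> attention E \<psi> \<theta> x i j" for i j
    using pos[of i] by (simp add: attention_def)
  ultimately show ?thesis
    by (simp add: stochastic_def attention_matrix_def)
qed

end

theory Submission
  imports Defs
begin

text \<open>
  A stochastic matrix \<open>W\<close> does not expand the sup norm, so the orbit of a vector \<open>v\<close> has a cluster
  point \<open>y\<close>, and the sup norms of successive differences along the orbit decrease to some \<open>L\<close>.
  Then all successive differences along the orbit of \<open>y\<close> have sup norm exactly \<open>L\<close>. Because the
  diagonal of \<open>W\<close> is positive, an entry \<open>\<plusminus>L\<close> of such a difference must already have been
  present, at the same index and with the same sign, in all earlier differences; these add up,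
  and boundedness of the orbit of \<open>y\<close> forces \<open>L = 0\<close>. So \<open>y\<close> is fixed by \<open>W\<close>, the distance of the
  orbit of \<open>v\<close> to \<open>y\<close> decreases, and it tends to 0 along a subsequence.
\<close>

lemma infnorm_le_cart:
  fixes v :: "real ^ 'n"
  assumes "\<And>i. \<bar>v $ i\<bar> \<le> c"
  shows "infnorm v \<le> c"
  unfolding infnorm_cart by (rule cSup_least) (use assms in auto)

lemma infnorm_attained_cart:
  fixes v :: "real ^ 'n"
  shows "\<exists>i. \<bar>v $ i\<bar> = infnorm v"
proof -
  have "infnorm v \<in> (\<lambda>b. \<bar>v \<bullet> b\<bar>) ` Basis"
    unfolding infnorm_Max by (rule Max_in) auto
  then show ?thesis
    by (auto simp: Basis_vec_def inner_axis)
qed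

text \<open>Each entry of \<open>W *v v\<close> is a weighted average of the entries of
  \<open>v\<close>.\<close>

lemma infnorm_stochastic_le:
  fixes W :: "real ^ 'n ^ 'n"
  assumes "stochastic W"
  shows "infnorm (W *v v) \<le> infnorm v"
proof (rule infnorm_le_cart)
  fix i
  have "\<bar>(W *v v) $ i\<bar> \<le> (\<Sum>j\<in>UNIV. \<bar>W $ i $ j * v $ j\<bar>)"
    by (simp add: matrix_vector_mult_def sum_abs)
  also have "\<dots> \<le> (\<Sum>j\<in>UNIV. W $ i $ j * infnorm v)"
    using assms
    by (intro sum_mono) (auto simp: abs_mult stochastic_def intro!: mult_left_mono component_le_infnorm_cart)
  also have "\<dots> = infnorm v"
    using assms by (simp add: stochastic_def flip: sum_distrib_right)
  finally show "\<bar>(W *v v) $ i\<bar> \<le> infnorm v" .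
qed

text \<open>An average of numbers at most \<open>c\<close> equals \<open>c\<close> only if every
  entry of positive weight equals \<open>c\<close>: the terms \<open>W $ i $ j * (c - v $ j)\<close>
  are nonnegative and sum to 0. The positive diagonal weight singles out index
  \<open>i\<close>.\<close>

lemma stochastic_extremal_component_nonneg:
  fixes W :: "real ^ 'n ^ 'n"
  assumes W: "stochastic W" and diag: "0 < W $ i $ i"
    and le: "infnorm v \<le> c" and eq: "(W *v v) $ i = c"
  shows "v $ i = c"
proof -
  have ge: "v $ j \<le> c" for j
    using component_le_infnorm_cart[of v j] le by linarith
  have "(\<Sum>j\<in>UNIV. W $ i $ j * (c - v $ j)) = c * (\<Sum>j\<in>UNIV. W $ i $ j) - (W *v v) $ i"
    by (simp add: matrix_vector_mult_def right_diff_distrib sum_subtractf sum_distrib_left mult.commute)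
  also have "\<dots> = 0"
    using W eq by (simp add: stochastic_def)
  finally have "W $ i $ i * (c - v $ i) = 0"
    using W ge by (subst (asm) sum_nonneg_eq_0_iff) (auto simp: stochastic_def)
  then show ?thesis
    using diag by simp
qed

text \<open>A negative extreme value reduces to the previous case by passing to \<open>- v\<close>
  and \<open>- c\<close>.\<close>

lemma stochastic_extremal_component:
  fixes W :: "real ^ 'n ^ 'n"
  assumes W: "stochastic W" and diag: "0 < W $ i $ i"
    and le: "infnorm v \<le> \<bar>c\<bar>" and eq: "(W *v v) $ i = c"
  shows "v $ i = c"
proof (cases "0 \<le> c")
  case True
  then show ?thesis
    using stochastic_extremal_component_nonneg[OF W diag, of v c] le eq by simp
next
  case False
  have "(W *v (- v)) $ i = - c"
    using eq by (simp add: matrix_vector_mult_def sum_negf)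
  then show ?thesis
    using stochastic_extremal_component_nonneg[OF W diag, of "- v" "- c"] le False
    by (simp add: infnorm_neg)
qed

lemma stochastic_powers_convergent:
  fixes W :: "real ^ 'n ^ 'n"
  assumes W: "stochastic W" and diag: "\<And>i. 0 < W $ i $ i"
  shows "convergent (\<lambda>k. (((*v) W) ^^ k) v)"
proof -
  define T where "T = (*v) W"
  define u where "u k = (T ^^ k) v" for k
  have diff: "T a - T b = T (a - b)" for a b
    by (simp add: T_def matrix_vector_mult_diff_distrib)
  have contr: "infnorm (T a) \<le> infnorm a" for a
    unfolding T_def by (rule infnorm_stochastic_le[OF W])
  have contr_pow: "infnorm ((T ^^ k) a) \<le> infnorm a" for k a
    by (induction k) (auto intro: order_trans[OF contr])
  have T_lim: "(\<lambda>k. T (f k)) \<longlonglongrightarrow> T a" if "f \<longlonglongrightarrow> a" for f a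
    unfolding T_def
    by (rule bounded_linear.tendsto[OF matrix_vector_mul_bounded_linear that])

  have "bounded (range u)"
  proof (rule boundedI)
    fix z assume "z \<in> range u"
    then obtain k where z: "z = u k" by auto
    have "norm z \<le> sqrt DIM(real ^ 'n) * infnorm z"
      by (rule norm_le_infnorm)
    also have "\<dots> \<le> sqrt DIM(real ^ 'n) * infnorm v"
      unfolding z u_def by (intro mult_left_mono contr_pow) simp
    finally show "norm z \<le> sqrt DIM(real ^ 'n) * infnorm v" .
  qed
  then obtain y r where r: "strict_mono r" and "(u \<circ> r) \<longlonglongrightarrow> y"
    using bounded_imp_convergent_subsequence by blast
  then have cluster: "(\<lambda>k. u (r k)) \<longlonglongrightarrow> y"
    by (simp add: o_def)
  \<comment> \<open>By continuity of \<open>T\<close>, the whole orbit of \<open>y\<close> consists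
    of cluster points of \<open>u\<close>, all reached along shifts of the same subsequence
    \<open>r\<close>.\<close>
  have shift: "(\<lambda>k. u (m + r k)) \<longlonglongrightarrow> (T ^^ m) y" for m
    using cluster
  proof (induction m)
    case (Suc m)
    then show ?case
      using T_lim[OF Suc.IH] by (simp add: u_def)
  qed simp

  define g where "g k = infnorm (u (Suc k) - u k)" for k
  have "decseq g"
    unfolding decseq_Suc_iff g_def u_def by (auto simp: diff intro: contr)
  then obtain L where L: "g \<longlonglongrightarrow> L"
    using decseq_convergent[of g 0] by (auto simp: g_def infnorm_pos_le)
  define w where "w m = (T ^^ Suc m) y - (T ^^ m) y" for m
  \<comment> \<open>The norms that converge to \<open>infnorm (w m)\<close> are
    \<open>g (m + r k)\<close>, and all of \<open>g\<close> tends to \<open>L\<close>, so the limit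
    does not depend on \<open>m\<close>.\<close>
  have w_norm: "infnorm (w m) = L" for m
  proof (rule LIMSEQ_unique)
    show "(\<lambda>k. infnorm (u (Suc m + r k) - u (m + r k))) \<longlonglongrightarrow> infnorm (w m)"
      unfolding w_def by (intro tendsto_infnorm tendsto_diff shift)
    have "filterlim (\<lambda>k. m + r k) at_top sequentially"
      by (rule filterlim_at_top_mono[OF filterlim_subseq[OF r]]) simp
    from filterlim_compose[OF L this]
    show "(\<lambda>k. infnorm (u (Suc m + r k) - u (m + r k))) \<longlonglongrightarrow> L"
      by (simp add: g_def)
  qed
  have w_Suc: "w (Suc m) = T (w m)" for m
    by (simp add: w_def diff)
  have bound: "real n * L \<le> 2 * infnorm y" for n
  proof -
    \<comment> \<open>The index is taken from the last difference, since extremality passes from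
      \<open>T (w m)\<close> back to \<open>w m\<close>; hence the downward induction from
      \<open>n\<close>.\<close>
    obtain i where i: "\<bar>w n $ i\<bar> = L"
      using infnorm_attained_cart[of "w n"] w_norm by auto
    have const: "w m $ i = w n $ i" if "m \<le> n" for m
      using that
    proof (induction rule: inc_induct)
      case (step m)
      have "(W *v w m) $ i = w n $ i"
        using step.IH by (simp add: w_Suc T_def)
      with stochastic_extremal_component[OF W diag] show ?case
        by (metis i order_refl w_norm)
    qed simp
    \<comment> \<open>At index \<open>i\<close> this displacement is a sum of \<open>n\<close> equal
      entries of size \<open>L\<close>, so nothing cancels.\<close>
    have "(\<Sum>m<n. w m) = (T ^^ n) y - y"
      unfolding w_def by (subst sum_lessThan_telescope) simp
    then have "((T ^^ n) y - y) $ i = (\<Sum>m<n. w m $ i)"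
      by (metis sum_component)
    also have "\<dots> = (\<Sum>m<n. w n $ i)"
      by (rule sum.cong) (auto intro: const)
    also have "\<dots> = real n * w n $ i"
      by simp
    finally have "real n * L = \<bar>((T ^^ n) y - y) $ i\<bar>"
      using i by (simp add: abs_mult)
    also have "\<dots> \<le> \<bar>(T ^^ n) y $ i\<bar> + \<bar>y $ i\<bar>"
      by simp
    also have "\<dots> \<le> infnorm ((T ^^ n) y) + infnorm y"
      by (intro add_mono component_le_infnorm_cart)
    also have "\<dots> \<le> 2 * infnorm y"
      using contr_pow[of n y] by simp
    finally show ?thesis .
  qed
  have "L = 0"
  proof (rule ccontr)
    assume "L \<noteq> 0"
    then have "0 < L"
      using w_norm[of 0] infnorm_pos_le[of "w 0"] by simp
    then obtain n where "2 * infnorm y < real n * L"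
      using ex_less_of_nat_mult by blast
    then show False
      using bound[of n] by simp
  qed
  then have "w 0 = 0"
    using w_norm[of 0] by (simp add: infnorm_eq_0)
  then have fixed: "T y = y"
    by (simp add: w_def)

  \<comment> \<open>A monotone sequence has the same limit as its subsequence along
    \<open>r\<close>, which is 0.\<close>
  define h where "h k = infnorm (u k - y)" for k
  have "u (Suc k) - y = T (u k - y)" for k
    using diff[of "u k" y] by (simp add: u_def fixed)
  then have "decseq h"
    unfolding decseq_Suc_iff h_def by (simp add: contr)
  then obtain c where c: "h \<longlonglongrightarrow> c"
    using decseq_convergent[of h 0] by (auto simp: h_def infnorm_pos_le)
  have "(\<lambda>k. h (r k)) \<longlonglongrightarrow> infnorm (y - y)"
    unfolding h_def by (intro tendsto_infnorm tendsto_diff cluster tendsto_const)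
  moreover have "(\<lambda>k. h (r k)) \<longlonglongrightarrow> c"
    using filterlim_compose[OF c filterlim_subseq[OF r]] .
  ultimately have "c = 0"
    using LIMSEQ_unique by (fastforce simp: infnorm_0)
  have "(\<lambda>k. u k - y) \<longlonglongrightarrow> 0"
  \<comment> \<open>Convergence is meant in the Euclidean norm; the dimension factor compares it
    with the sup norm.\<close>
  proof (rule Lim_null_comparison)
    show "\<forall>\<^sub>F k in sequentially. norm (u k - y) \<le> sqrt DIM(real ^ 'n) * h k"
      unfolding h_def by (intro always_eventually allI norm_le_infnorm)
    show "(\<lambda>k. sqrt DIM(real ^ 'n) * h k) \<longlonglongrightarrow> 0"
      using tendsto_mult_right_zero c \<open>c = 0\<close> by blast
  qed
  then have "u \<longlonglongrightarrow> y"
    by (simp add: LIM_zero_iff)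
  then show ?thesis
    unfolding u_def T_def by (rule convergentI)
qed

text \<open>Left multiplication by \<open>W\<close> acts on each column separately, which reduces
  the matrix iteration to orbits of vectors.\<close>

lemma column_recurrent_aggregation:
  fixes W :: "real ^ 'n ^ 'n" and X :: "real ^ 'd ^ 'n"
  shows "column c (recurrent_aggregation W X k) = (((*v) W) ^^ k) (column c X)"
  by (induction k)
    (auto simp: vec_eq_iff column_def matrix_matrix_mult_def matrix_vector_mult_def)

lemma recurrent_aggregation_convergent:
  fixes W :: "real ^ 'n ^ 'n" and X :: "real ^ 'd ^ 'n"
  assumes "stochastic W" and "\<And>i. 0 < W $ i $ i"
  shows "convergent (recurrent_aggregation W X)"
proof -
  have "\<forall>c. \<exists>l. (\<lambda>k. column c (recurrent_aggregation W X k)) \<longlonglongrightarrow> l"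
    using stochastic_powers_convergent[OF assms]
    by (simp add: column_recurrent_aggregation convergent_def)
  then obtain l where l: "\<And>c. (\<lambda>k. column c (recurrent_aggregation W X k)) \<longlonglongrightarrow> l c"
    by metis
  have "recurrent_aggregation W X \<longlonglongrightarrow> (\<chi> i c. l c $ i)"
  proof (intro vec_tendstoI)
    fix i c
    show "(\<lambda>k. recurrent_aggregation W X k $ i $ c) \<longlonglongrightarrow> (\<chi> i c. l c $ i) $ i $ c"
      using tendsto_vec_nth[OF l[of c], of i] by (simp add: column_def)
  qed
  then show ?thesis
    by (auto simp: convergent_def)
qed

text \<open>Every node lies in its own neighbourhood, so its self-weight is a quotient of positive
  numbers.\<close>

lemma attention_matrix_diagonal_pos:
  fixes E :: "('n::finite \<times> 'n) set"
  shows "0 < attention_matrix E \<psi> \<theta> x $ i $ i"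
proof -
  have "0 < (\<Sum>k\<in>nbhd E i. exp (\<psi> (x i) (x k) \<theta>))"
    by (rule sum_pos) (auto simp: nbhd_def)
  then show ?thesis
    by (simp add: attention_matrix_def attention_def nbhd_def)
qed

theorem theorem1:
  fixes E :: "('n::finite \<times> 'n) set"
    and \<psi> :: "real ^ 'd::finite \<Rightarrow> real ^ 'd \<Rightarrow> 'p \<Rightarrow> real"
    and \<theta> :: 'p
    and x :: "'n \<Rightarrow> real ^ 'd"
    and W :: "real ^ 'n ^ 'n"
    and X :: "real ^ 'd ^ 'n"
  assumes "W = attention_matrix E \<psi> \<theta> x"
    and "X = feature_matrix x"
  shows "\<exists>Xstar :: real ^ 'd ^ 'n.
    (\<lambda>k. W ** recurrent_aggregation W X k) \<longlonglongrightarrow> Xstar"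
proof -
  have "convergent (recurrent_aggregation W X)"
    unfolding assms(1)
    by (intro recurrent_aggregation_convergent stochastic_attention_matrix attention_matrix_diagonal_pos)
  then obtain Xstar where "recurrent_aggregation W X \<longlonglongrightarrow> Xstar"
    by (auto simp: convergent_def)
  \<comment> \<open>The sequence in the claim is the iteration shifted by one index.\<close>
  from LIMSEQ_Suc[OF this] show ?thesis
    by auto
qed

end
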